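(* Consider an ISAC system sensing $L$ real parameters and serving $K$ users who do not cancel the interference from the sensing beams, and suppose that $$K\ge\frac{L(L+1)}{4}.$$ Let $\mathcal{A}^{\mathrm{NIC}}=\{(\mathbf{J}_{\mathbf{V}},\mathrm{vSINR}^{\mathrm{NIC}}_{\mathbf{V}}) : \mathbf{V}\in\mathbb{C}^{N_T\times(N_T+K)},\ \mathrm{tr}(\mathbf{V}\mathbf{V}^{H})\le P\}$. Then for every $(\mathbf{J},\boldsymbol{\gamma})\in\mathcal{A}^{\mathrm{NIC}}$ with $\boldsymbol{\gamma}>\mathbf{0}$ (entrywise) there exists $\mathbf{V}'\in\mathbb{C}^{N_T\times K}$ (exactly $K$ beamformers, no sensing beamformers) such that $\mathbf{J}_{\mathbf{V}'}=\mathbf{J}$, $\mathrm{vSINR}^{\mathrm{NIC}}_{\mathbf{V}'}\ge\boldsymbol{\gamma}$ (entrywise) and $\mathrm{tr}(\mathbf{V}'\mathbf{V}'^{H})\le P$.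
   Context: Integers $N_T,N_R,L,\Upsilon\ge1$, $K\ge0$; reals $\sigma^2>0$, $P>0$; fixed channel vectors $\mathbf{h}_1,\dots,\mathbf{h}_K\in\mathbb{C}^{N_T}$. Beamformers: for $N\ge K$, a beamforming matrix with $N$ beamformers is $\mathbf{V}=[\mathbf{v}_1,\dots,\mathbf{v}_K,\mathbf{V}_s]\in\mathbb{C}^{N_T\times N}$, with communication beamformers $\mathbf{v}_k\in\mathbb{C}^{N_T}$ and sensing beamformers $\mathbf{V}_s\in\mathbb{C}^{N_T\times(N-K)}$ (absent if $N=K$). Bayesian Fisher information matrix (BFIM): $\boldsymbol{\eta}\in\mathbb{R}^L$ is a random parameter vector with prior density $f$, and $\mathbf{G}^{(\boldsymbol{\eta})}\in\mathbb{C}^{N_R\times N_T}$ is a known deterministic differentiable function of $\boldsymbol{\eta}$ (all expectations below are assumed to exist). The BFIM is $\mathbf{J}_{\mathbf{V}}=\mathbf{C}+\mathbf{T}_{\mathbf{V}}\in\mathbb{R}^{L\times L}$, where $[\mathbf{C}]_{ij}=-\mathbb{E}[\partial^2\log f(\boldsymbol{\eta})/\partial\eta_i\partial\eta_j]$ and $[\mathbf{T}_{\mathbf{V}}]_{ij}=\frac{\Upsilon}{\sigma^2}\mathrm{tr}(\tilde{\mathbf{G}}_{ij}\mathbf{V}\mathbf{V}^{H})$ with $\tilde{\mathbf{G}}_{ij}=\mathbb{E}[\dot{\mathbf{G}}_i^{H}\dot{\mathbf{G}}_j+\dot{\mathbf{G}}_j^{H}\dot{\mathbf{G}}_i]$,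 $\dot{\mathbf{G}}_i=\partial\mathbf{G}^{(\boldsymbol{\eta})}/\partial\eta_i$. SINR without interference cancellation (NIC): $\mathrm{SINR}^{\mathrm{NIC}}_{k,\mathbf{V}}=\dfrac{|\mathbf{h}_k^{H}\mathbf{v}_k|^2}{\sum_{i\ne k}|\mathbf{h}_k^{H}\mathbf{v}_i|^2+\mathbf{h}_k^{H}\mathbf{V}_s\mathbf{V}_s^{H}\mathbf{h}_k+\sigma^2}$, and $\mathrm{vSINR}^{\mathrm{NIC}}_{\mathbf{V}}=(\mathrm{SINR}^{\mathrm{NIC}}_{1,\mathbf{V}},\dots,\mathrm{SINR}^{\mathrm{NIC}}_{K,\mathbf{V}})^{T}$. *)

theory Defs
  imports "HOL-Probability.Probability"
begin

definition ctranspose :: "complex^'n^'m \<Rightarrow> complex^'m^'n" where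
  "ctranspose A = map_matrix cnj (transpose A)"

text \<open>The product \<open>a\<^sup>H b\<close> of two complex column vectors.\<close>

definition cdot :: "complex^'n \<Rightarrow> complex^'n \<Rightarrow> complex" where
  "cdot a b = (\<Sum>i\<in>UNIV. cnj (a $ i) * b $ i)"

text \<open>\<open>tr (V V\<^sup>H)\<close>; the trace has vanishing imaginary part, see \<open>Im_trace_gram\<close>.\<close>

definition tx_power :: "complex^'c^'t \<Rightarrow> real" where
  "tx_power V = Re (trace (V ** ctranspose V))"

section \<open>Bayesian Fisher information matrix\<close>

definition partial :: "'l \<Rightarrow> (real^'l \<Rightarrow> 'b::real_normed_vector) \<Rightarrow> real^'l \<Rightarrow> 'b" where
  "partial i g x = vector_derivative (\<lambda>t. g (x + t *\<^sub>R axis i 1)) (at 0)"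

definition log_partial2 :: "(real^'l \<Rightarrow> real) \<Rightarrow> 'l \<Rightarrow> 'l \<Rightarrow> real^'l \<Rightarrow> real" where
  "log_partial2 f i j = partial i (partial j (\<lambda>x. ln (f x)))"

text \<open>
  The value \<open>log_partial2 f i j x\<close> is a genuine second partial derivative: \<open>ln\<close> is only evaluated
  at positive arguments and all derivatives involved exist.
\<close>

definition log_partial2_exists :: "(real^'l \<Rightarrow> real) \<Rightarrow> 'l \<Rightarrow> 'l \<Rightarrow> real^'l \<Rightarrow> bool" where
  "log_partial2_exists f i j x \<longleftrightarrow>
     (\<forall>\<^sub>F t in nhds 0.
        (\<forall>\<^sub>F s in nhds 0. f (x + t *\<^sub>R axis i 1 + s *\<^sub>R axis j 1) > 0) \<and>
        (\<lambda>s. ln (f (x + t *\<^sub>R axis i 1 + s *\<^sub>R axis j 1))) differentiable (at 0)) \<and>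
     (\<lambda>t. partial j (\<lambda>y. ln (f y)) (x + t *\<^sub>R axis i 1)) differentiable (at 0)"

definition prior_info :: "'w measure \<Rightarrow> ('w \<Rightarrow> real^'l) \<Rightarrow> (real^'l \<Rightarrow> real) \<Rightarrow> real^'l^'l" where
  "prior_info M \<eta> f = (\<chi> i j. - (\<integral>\<omega>. log_partial2 f i j (\<eta> \<omega>) \<partial>M))"

text \<open>The integrand of the matrix-valued expectation \<open>gram_mean\<close>.\<close>

definition gram_deriv ::
    "(real^'l \<Rightarrow> complex^'t^'r) \<Rightarrow> 'l \<Rightarrow> 'l \<Rightarrow> real^'l \<Rightarrow> complex^'t^'t" where
  "gram_deriv G i j x =
     ctranspose (partial i G x) ** partial j G x + ctranspose (partial j G x) ** partial i G x"

definition gram_mean ::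
    "'w measure \<Rightarrow> ('w \<Rightarrow> real^'l) \<Rightarrow> (real^'l \<Rightarrow> complex^'t^'r) \<Rightarrow> 'l \<Rightarrow> 'l \<Rightarrow> complex^'t^'t" where
  "gram_mean M \<eta> G i j = (\<integral>\<omega>. gram_deriv G i j (\<eta> \<omega>) \<partial>M)"

text \<open>
  The trace below has vanishing imaginary part, see \<open>Im_trace_gram_mean\<close>; \<open>Re\<close> only turns it into
  an element of type \<open>real\<close>.
\<close>

definition data_info ::
    "'w measure \<Rightarrow> ('w \<Rightarrow> real^'l) \<Rightarrow> (real^'l \<Rightarrow> complex^'t^'r) \<Rightarrow> nat \<Rightarrow> real \<Rightarrow> complex^'c^'t
      \<Rightarrow> real^'l^'l" where
  "data_info M \<eta> G \<Upsilon> \<sigma>2 V =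
     (\<chi> i j. real \<Upsilon> / \<sigma>2 * Re (trace (gram_mean M \<eta> G i j ** V ** ctranspose V)))"

definition bfim ::
    "'w measure \<Rightarrow> ('w \<Rightarrow> real^'l) \<Rightarrow> (real^'l \<Rightarrow> real) \<Rightarrow> (real^'l \<Rightarrow> complex^'t^'r) \<Rightarrow> nat \<Rightarrow> real
      \<Rightarrow> complex^'c^'t \<Rightarrow> real^'l^'l" where
  "bfim M \<eta> f G \<Upsilon> \<sigma>2 V = prior_info M \<eta> f + data_info M \<eta> G \<Upsilon> \<sigma>2 V"

section \<open>SINR without interference cancellation\<close>

text \<open>
  The columns of a beamforming matrix are indexed by a finite type \<open>'c\<close>. An injection
  \<open>c :: 'k \<Rightarrow> 'c\<close> tells which column is the communication beamformer of which user; the columns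
  outside \<open>range c\<close> are the sensing beamformers. So \<open>c = Inl\<close> on \<open>'k + 's\<close> describes
  \<open>[v\<^sub>1, ..., v\<^sub>K, V\<^sub>s]\<close> with \<open>CARD('s)\<close> sensing beamformers, and \<open>c = id\<close> on \<open>'k\<close> describes
  \<open>[v\<^sub>1, ..., v\<^sub>K]\<close> without sensing beamformers.

  Here \<open>V\<^sub>s\<close> is padded with zero columns in the communication positions, which does not affect
  \<open>V\<^sub>s V\<^sub>s\<^sup>H\<close>.
\<close>

definition sensing_part :: "('k \<Rightarrow> 'c) \<Rightarrow> complex^'c^'t \<Rightarrow> complex^'c^'t" where
  "sensing_part c V = (\<chi> i n. if n \<in> range c then 0 else V $ i $ n)"

definition sinr_nic ::
    "('k::finite \<Rightarrow> 'c) \<Rightarrow> ('k \<Rightarrow> complex^'t) \<Rightarrow> real \<Rightarrow> complex^'c^'t \<Rightarrow> 'k \<Rightarrow> real" where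
  "sinr_nic c h \<sigma>2 V k =
     (cmod (cdot (h k) (column (c k) V)))\<^sup>2 /
     ((\<Sum>i\<in>UNIV - {k}. (cmod (cdot (h k) (column (c i) V)))\<^sup>2) +
      Re (cdot (h k) ((sensing_part c V ** ctranspose (sensing_part c V)) *v h k)) + \<sigma>2)"

definition vsinr_nic ::
    "('k::finite \<Rightarrow> 'c) \<Rightarrow> ('k \<Rightarrow> complex^'t) \<Rightarrow> real \<Rightarrow> complex^'c^'t \<Rightarrow> real^'k" where
  "vsinr_nic c h \<sigma>2 V = (\<chi> k. sinr_nic c h \<sigma>2 V k)"

text \<open>The matrices \<open>V\<close> below have \<open>CARD('k)\<close> communication and \<open>CARD('t)\<close> sensing beamformers.\<close>

definition achievable_nic ::
    "'w measure \<Rightarrow> ('w \<Rightarrow> real^'l) \<Rightarrow> (real^'l \<Rightarrow> real) \<Rightarrow> (real^'l \<Rightarrow> complex^'t^'r) \<Rightarrow> nat \<Rightarrow> real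
      \<Rightarrow> ('k::finite \<Rightarrow> complex^'t) \<Rightarrow> real \<Rightarrow> ((real^'l^'l) \<times> (real^'k)) set" where
  "achievable_nic M \<eta> f G \<Upsilon> \<sigma>2 h P =
     {(bfim M \<eta> f G \<Upsilon> \<sigma>2 V, vsinr_nic Inl h \<sigma>2 V) | V :: complex^('k + 't)^'t. tx_power V \<le> P}"

section \<open>The traces and the quadratic form above are real\<close>

lemma ctranspose_nth [simp]: "ctranspose A $ i $ j = cnj (A $ j $ i)"
  by (simp add: ctranspose_def transpose_def)

lemma ctranspose_ctranspose [simp]: "ctranspose (ctranspose A) = A"
  by (simp add: vec_eq_iff)

lemma ctranspose_mult: "ctranspose (A ** B) = ctranspose B ** ctranspose A"
  by (simp add: vec_eq_iff matrix_matrix_mult_def mult.commute)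

lemma ctranspose_add: "ctranspose (A + B) = ctranspose A + ctranspose B"
  by (simp add: vec_eq_iff)

lemma trace_ctranspose: "trace (ctranspose A) = cnj (trace A)"
  by (simp add: trace_def)

lemma bounded_linear_ctranspose: "bounded_linear (ctranspose :: complex^'n^'m \<Rightarrow> _)"
  by (rule linear_conv_bounded_linear[THEN iffD1])
     (auto intro!: linearI simp: vec_eq_iff)

lemma Im_trace_gram: "Im (trace (V ** ctranspose V)) = 0"
proof -
  have "cnj (trace (V ** ctranspose V)) = trace (V ** ctranspose V)"
    by (simp add: trace_ctranspose[symmetric] ctranspose_mult)
  then show ?thesis
    by (metis Reals_cnj_iff complex_is_Real_iff)
qed

lemma ctranspose_gram_mean:
  assumes "integrable M (\<lambda>\<omega>. gram_deriv G i j (\<eta> \<omega>))"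
  shows "ctranspose (gram_mean M \<eta> G i j) = gram_mean M \<eta> G i j"
proof -
  have "ctranspose (gram_deriv G i j x) = gram_deriv G i j x" for x
    by (simp add: gram_deriv_def ctranspose_add ctranspose_mult add.commute)
  then show ?thesis
    using integral_bounded_linear[OF bounded_linear_ctranspose assms]
    by (simp add: gram_mean_def)
qed

lemma Im_trace_gram_mean:
  assumes "integrable M (\<lambda>\<omega>. gram_deriv G i j (\<eta> \<omega>))"
  shows "Im (trace (gram_mean M \<eta> G i j ** V ** ctranspose V)) = 0"
proof -
  have "cnj (trace (gram_mean M \<eta> G i j ** V ** ctranspose V)) =
        trace ((V ** ctranspose V) ** gram_mean M \<eta> G i j)"
    by (simp add: trace_ctranspose[symmetric] ctranspose_mult ctranspose_gram_mean[OF assms]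
        matrix_mul_assoc)
  also have "\<dots> = trace (gram_mean M \<eta> G i j ** V ** ctranspose V)"
    by (subst trace_mul_sym) (simp add: matrix_mul_assoc)
  finally show ?thesis
    by (metis Reals_cnj_iff complex_is_Real_iff)
qed

lemma cdot_gram:
  "cdot a ((V ** ctranspose V) *v a) = of_real (\<Sum>n\<in>UNIV. (cmod (cdot a (column n V)))\<^sup>2)"
proof -
  have "cdot a ((V ** ctranspose V) *v a) =
        (\<Sum>i\<in>UNIV. \<Sum>j\<in>UNIV. \<Sum>n\<in>UNIV. cnj (a $ i) * V $ i $ n * (cnj (V $ j $ n) * a $ j))"
    by (simp add: cdot_def matrix_vector_mult_def matrix_matrix_mult_def sum_distrib_left
        sum_distrib_right mult_ac)
  also have "\<dots> = (\<Sum>i\<in>UNIV. \<Sum>n\<in>UNIV. \<Sum>j\<in>UNIV. cnj (a $ i) * V $ i $ n * (cnj (V $ j $ n) * a $ j))"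
    by (intro sum.cong refl sum.swap)
  also have "\<dots> = (\<Sum>n\<in>UNIV. \<Sum>i\<in>UNIV. \<Sum>j\<in>UNIV. cnj (a $ i) * V $ i $ n * (cnj (V $ j $ n) * a $ j))"
    by (rule sum.swap)
  also have "\<dots> = (\<Sum>n\<in>UNIV. cdot a (column n V) * cnj (cdot a (column n V)))"
    unfolding cdot_def column_def cnj_sum sum_product by (simp add: mult_ac)
  finally show ?thesis
    by (simp only: complex_norm_square[symmetric] of_real_sum)
qed

end

theory Submission
  imports Defs
begin

text \<open>
  Rotating \<open>v\<^sub>k\<close> against a sensing column by a unitary \<open>2 \<times> 2\<close> matrix keeps \<open>V V\<^sup>H\<close>, hence the BFIM,
  the power and the total power received by each user. If the sensing column is not orthogonal to
  \<open>h\<^sub>k\<close>, a suitable rotation increases \<open>|h\<^sub>k\<^sup>H v\<^sub>k|\<close>; so at a maximum of \<open>\<Sum>\<^sub>k |h\<^sub>k\<^sup>H v\<^sub>k|\<close> over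
  matrices with the given \<open>V V\<^sup>H\<close>, all sensing columns are invisible to all users. Adding multiples of
  an invisible column \<open>s\<close> to the \<open>v\<^sub>k\<close> leaves every SINR unchanged. Together with the weight of
  \<open>s s\<^sup>H\<close> these multiples have \<open>2 K + 1 > L (L + 1) / 2\<close> real degrees of freedom, more than the
  entries of the BFIM impose constraints, so \<open>s\<close> can be absorbed into the \<open>v\<^sub>k\<close> with the BFIM kept and,
  up to the sign of the direction, without additional power.
\<close>

section \<open>Quadratic forms, and traces as sums over columns\<close>

lemma cdot_add_right: "cdot a (x + y) = cdot a x + cdot a y"
  by (simp add: cdot_def distrib_left sum.distrib)

lemma cdot_add_left: "cdot (a + b) x = cdot a x + cdot b x"
  by (simp add: cdot_def distrib_right sum.distrib)

lemma cdot_scale_right: "cdot a (c *s x) = c * cdot a x"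
  by (simp add: cdot_def sum_distrib_left mult_ac)

lemma cdot_scale_left: "cdot (c *s a) x = cnj c * cdot a x"
  by (simp add: cdot_def sum_distrib_left mult_ac)

lemma cdot_self: "cdot x x = of_real ((norm x)\<^sup>2)"
  unfolding cdot_def norm_vec_def L2_set_def
  by (simp add: sum_nonneg complex_norm_square mult.commute flip: of_real_power)

text \<open>One column's share of \<open>Re (trace (A ** V ** ctranspose V))\<close>. With
  \<open>A\<close> a \<open>gram_mean\<close> it measures information, with \<open>A = mat 1\<close>
  power, so both are treated by the same formulas.\<close>

definition qform :: "complex^'n^'n \<Rightarrow> complex^'n \<Rightarrow> real" where
  "qform A v = Re (cdot v (A *v v))"

definition qpolar :: "complex^'n^'n \<Rightarrow> complex^'n \<Rightarrow> complex^'n \<Rightarrow> real" where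
  "qpolar A u v = Re (cdot u (A *v v)) + Re (cdot v (A *v u))"

lemma qform_mat_1: "qform (mat 1) v = (norm v)\<^sup>2"
  by (simp add: qform_def cdot_self)

text \<open>The quadratic term is \<open>qform A s\<close> times a factor independent of
  \<open>A\<close>. A single change in the weight of \<open>s\<close> can therefore compensate it
  for all \<open>A\<close> at once.\<close>

lemma qform_add_scaled:
  "qform A (v + (of_real t * a) *s s) = qform A v + t * qpolar A v (a *s s) + t\<^sup>2 * (cmod a)\<^sup>2 * qform A s"
proof -
  have "cnj a * a = of_real ((cmod a)\<^sup>2)"
    by (metis complex_norm_square mult.commute of_real_power)
  then have "cnj (of_real t * a) * (of_real t * a) = of_real (t\<^sup>2 * (cmod a)\<^sup>2)"
    by (simp add: power2_eq_square mult_ac)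
  then have *: "cnj (of_real t * a) * ((of_real t * a) * z) = of_real (t\<^sup>2 * (cmod a)\<^sup>2) * z" for z
    by (metis mult.assoc)
  have "qform A (v + (of_real t * a) *s s) = Re (cdot v (A *v v)) + Re (of_real t * (a * cdot v (A *v s)))
     + Re (of_real t * (cnj a * cdot s (A *v v))) + Re (cnj (of_real t * a) * ((of_real t * a) * cdot s (A *v s)))"
    unfolding qform_def
    by (simp add: matrix_vector_right_distrib cdot_add_right cdot_add_left cdot_scale_right
        cdot_scale_left vector_scalar_commute algebra_simps)
  also have "\<dots> = qform A v + t * qpolar A v (a *s s) + t\<^sup>2 * (cmod a)\<^sup>2 * qform A s"
    unfolding * by (simp add: qform_def qpolar_def vector_scalar_commute cdot_scale_right
        cdot_scale_left distrib_left)
  finally show ?thesis .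
qed

lemma qpolar_scaled:
  "qpolar A v (a *s s) = Re (a * cdot v (A *v s)) + Re (cnj a * cdot s (A *v v))"
  by (simp add: qpolar_def vector_scalar_commute cdot_scale_right cdot_scale_left)

lemma trace_mult_gram:
  "trace (A ** V ** ctranspose V) = (\<Sum>n\<in>UNIV. cdot (column n V) (A *v column n V))"
proof -
  have "trace (A ** V ** ctranspose V) = trace (ctranspose V ** (A ** V))"
    by (rule trace_mul_sym)
  also have "\<dots> = (\<Sum>n\<in>UNIV. cdot (column n V) (A *v column n V))"
    by (simp add: trace_def matrix_matrix_mult_def matrix_vector_mult_def cdot_def column_def)
  finally show ?thesis .
qed

lemma tx_power_eq: "tx_power V = (\<Sum>n\<in>UNIV. (norm (column n V))\<^sup>2)"
  using trace_mult_gram[of "mat 1" V]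
  by (simp add: tx_power_def cdot_self flip: of_real_power)

section \<open>Absorbing an invisible column into the communication columns\<close>

lemma common_zero_of_functionals:
  fixes \<phi> :: "'i \<Rightarrow> 'a::euclidean_space \<Rightarrow> real"
  assumes "finite I" "card I < DIM('a)" "\<And>i. i \<in> I \<Longrightarrow> linear (\<phi> i)"
  obtains x where "x \<noteq> 0" "\<And>i. i \<in> I \<Longrightarrow> \<phi> i x = 0"
proof -
  \<comment> \<open>These are the Riesz representatives of the functionals. There are too few to
    span the space, so a nonzero vector is orthogonal to all of them.\<close>
  let ?W = "(\<lambda>i. adjoint (\<phi> i) 1) ` I"
  have "dim ?W < DIM('a)"
    using assms(1,2) dim_le_card'[of ?W] card_image_le[of I "\<lambda>i. adjoint (\<phi> i) 1"] by simp
  then obtain x where "x \<noteq> 0" and x: "\<And>y. y \<in> span ?W \<Longrightarrow> orthogonal x y"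
    using orthogonal_to_subspace_exists by blast
  have "\<phi> i x = 0" if "i \<in> I" for i
    using adjoint_works[OF assms(3)[OF that], of x 1] x[of "adjoint (\<phi> i) 1"] that
    by (simp add: orthogonal_def inner_commute span_base)
  with \<open>x \<noteq> 0\<close> show thesis using that by blast
qed

text \<open>
  After replacing \<open>v k\<close> by \<open>v k + t a\<^sub>k s\<close> and \<open>s s\<^sup>H\<close> by \<open>(1 + t d - t\<^sup>2 |a|\<^sup>2) s s\<^sup>H\<close>, the covariance
  is affine in \<open>t\<close>, with slope linear in the \<open>2 K + 1\<close> real parameters \<open>(a, d)\<close>.
\<close>

lemma absorb_vector:
  fixes v :: "'k::finite \<Rightarrow> complex^'t" and \<A> :: "(complex^'t^'t) set"
  assumes "finite \<A>" "card \<A> \<le> 2 * CARD('k)"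
  obtains c where
    "\<And>A. A \<in> \<A> \<Longrightarrow> (\<Sum>k\<in>UNIV. qform A (v k + c k *s s)) = (\<Sum>k\<in>UNIV. qform A (v k)) + qform A s"
    "(\<Sum>k\<in>UNIV. (norm (v k + c k *s s))\<^sup>2) \<le> (\<Sum>k\<in>UNIV. (norm (v k))\<^sup>2) + (norm s)\<^sup>2"
proof (cases "s = 0")
  case True
  then show thesis
    using that[of "\<lambda>_. 0"] by (simp add: qform_def cdot_def)
next
  case False
  define \<phi> where "\<phi> A x = (\<Sum>k\<in>UNIV. qpolar A (v k) (fst x $ k *s s)) + snd x * qform A s"
    for A and x :: "(complex^'k) \<times> real"
  have lin: "linear (\<phi> A)" for A
    unfolding \<phi>_def qpolar_scaled
    by (rule linearI)
       (simp_all add: algebra_simps sum.distrib sum_subtractf sum_distrib_left)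
  \<comment> \<open>The dimension is 2 K + 1: the real coordinate for the weight of \<open>s\<close>
    makes the bound 2 K sufficient.\<close>
  have "card \<A> < DIM((complex^'k) \<times> real)"
    using assms(2) by simp
  then obtain x where x: "x \<noteq> 0" "\<And>A. A \<in> \<A> \<Longrightarrow> \<phi> A x = 0"
    using common_zero_of_functionals[OF assms(1)] lin by metis
  \<comment> \<open>Power is not among the constraints. Its slope is linear in the direction, so
    \<open>x\<close> or \<open>- x\<close> does not increase it.\<close>
  obtain y where y: "y \<noteq> 0" "\<And>A. A \<in> \<A> \<Longrightarrow> \<phi> A y = 0" "\<phi> (mat 1) y \<le> 0"
  proof (cases "\<phi> (mat 1) x \<le> 0")
    case True
    then show thesis using x that[of x] by blast
  next
    case False
    then show thesis using x that[of "- x"] by (simp add: linear_neg[OF lin])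
  qed
  define N where "N = (\<Sum>k\<in>UNIV. (cmod (fst y $ k))\<^sup>2)"
  \<comment> \<open>At this \<open>t\<close> the remaining weight 1 + t d - t^2 N of
    \<open>s\<close> is zero: \<open>s\<close> is absorbed completely.\<close>
  obtain t where t: "t \<ge> 0" "t\<^sup>2 * N = 1 + t * snd y"
  proof (cases "fst y = 0")
    case True
    then have "snd y \<noteq> 0" using y(1) by (auto simp: prod_eq_iff)
    \<comment> \<open>With no change to the \<open>v k\<close>, the power slope is just d |s|^2. As
      \<open>s\<close> is nonzero this forces d < 0, and the weight 1 + t d vanishes at t =
      -1/d.\<close>
    moreover have "snd y * (norm s)\<^sup>2 \<le> 0"
      using y(3) True by (simp add: \<phi>_def qform_mat_1 qpolar_def cdot_def)
    ultimately have "snd y < 0"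
      using False by (auto simp: mult_le_0_iff)
    then show thesis
      using that[of "- 1 / snd y"] True by (simp add: N_def divide_le_0_iff)
  next
    case False
    then obtain k where "fst y $ k \<noteq> 0" by (auto simp: vec_eq_iff)
    then have "N > 0"
      unfolding N_def by (intro sum_pos2[where i = k]) auto
    \<comment> \<open>\<open>T\<close> is large enough that t^2 N - t d, which is 0 at t = 0, has
      reached 1 by t = T.\<close>
    define T where "T = (1 + \<bar>snd y\<bar>) / N + 1"
    have "T \<ge> 1" using \<open>N > 0\<close> by (simp add: T_def)
    have "T * N \<ge> 1 + \<bar>snd y\<bar>" using \<open>N > 0\<close> by (simp add: T_def field_simps)
    then have "T * (T * N - snd y) \<ge> 1 * 1"
      using \<open>T \<ge> 1\<close> by (intro mult_mono) auto
    then have "1 \<le> T\<^sup>2 * N - T * snd y"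
      by (simp add: right_diff_distrib power2_eq_square mult.assoc)
    then have "\<exists>t\<ge>0. t \<le> T \<and> t\<^sup>2 * N - t * snd y = 1"
      using \<open>T \<ge> 1\<close> by (intro IVT') (auto intro!: continuous_intros)
    then show thesis using that by (auto simp: algebra_simps)
  qed
  define c where "c k = of_real t * fst y $ k" for k
  have sum_eq: "(\<Sum>k\<in>UNIV. qform A (v k + c k *s s)) =
      (\<Sum>k\<in>UNIV. qform A (v k)) + qform A s + t * \<phi> A y" for A
  proof -
    have "(\<Sum>k\<in>UNIV. qform A (v k + c k *s s)) = (\<Sum>k\<in>UNIV. qform A (v k)) +
        t * (\<Sum>k\<in>UNIV. qpolar A (v k) (fst y $ k *s s)) + t\<^sup>2 * N * qform A s"
      by (simp add: c_def qform_add_scaled sum.distrib N_def sum_distrib_left sum_distrib_right mult_ac)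
    then show ?thesis
      unfolding t(2) by (simp add: \<phi>_def algebra_simps)
  qed
  show thesis
  proof (rule that)
    show "(\<Sum>k\<in>UNIV. (norm (v k + c k *s s))\<^sup>2) \<le> (\<Sum>k\<in>UNIV. (norm (v k))\<^sup>2) + (norm s)\<^sup>2"
      using sum_eq[of "mat 1"] mult_nonneg_nonpos[OF t(1) y(3)] by (simp add: qform_mat_1)
  qed (simp add: sum_eq y(2))
qed

text \<open>Columns are absorbed one at a time. Each is orthogonal to every \<open>h j\<close>, so
  the received amplitudes survive each step and the power bounds add up.\<close>

lemma absorb_vectors:
  fixes v :: "'k::finite \<Rightarrow> complex^'t" and \<A> :: "(complex^'t^'t) set"
  assumes "finite \<A>" "card \<A> \<le> 2 * CARD('k)"
    and "finite N" and "\<And>n j. n \<in> N \<Longrightarrow> cdot (h j) (s n) = 0"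
  shows "\<exists>w.
    (\<forall>A\<in>\<A>. (\<Sum>k\<in>UNIV. qform A (w k)) = (\<Sum>k\<in>UNIV. qform A (v k)) + (\<Sum>n\<in>N. qform A (s n))) \<and>
    (\<Sum>k\<in>UNIV. (norm (w k))\<^sup>2) \<le> (\<Sum>k\<in>UNIV. (norm (v k))\<^sup>2) + (\<Sum>n\<in>N. (norm (s n))\<^sup>2) \<and>
    (\<forall>j k. cdot (h j) (w k) = cdot (h j) (v k))"
    (is "\<exists>w. ?P N w")
  using assms(3,4)
proof (induction N)
  case empty
  show ?case by auto
next
  case (insert n N)
  have orth: "cdot (h j) (s n) = 0" for j
    using insert.prems by simp
  have "\<exists>w. ?P N w"
    using insert.prems by (intro insert.IH) simp
  then obtain w where w:
    "\<forall>A\<in>\<A>. (\<Sum>k\<in>UNIV. qform A (w k)) = (\<Sum>k\<in>UNIV. qform A (v k)) + (\<Sum>n\<in>N. qform A (s n))"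
    "(\<Sum>k\<in>UNIV. (norm (w k))\<^sup>2) \<le> (\<Sum>k\<in>UNIV. (norm (v k))\<^sup>2) + (\<Sum>n\<in>N. (norm (s n))\<^sup>2)"
    "\<forall>j k. cdot (h j) (w k) = cdot (h j) (v k)"
    by (elim exE conjE)
  obtain c where c:
    "\<And>A. A \<in> \<A> \<Longrightarrow> (\<Sum>k\<in>UNIV. qform A (w k + c k *s s n)) = (\<Sum>k\<in>UNIV. qform A (w k)) + qform A (s n)"
    "(\<Sum>k\<in>UNIV. (norm (w k + c k *s s n))\<^sup>2) \<le> (\<Sum>k\<in>UNIV. (norm (w k))\<^sup>2) + (norm (s n))\<^sup>2"
    using absorb_vector[OF assms(1,2), of w "s n"] by blast
  show ?case
  proof (intro exI conjI allI ballI)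
    show "(\<Sum>k\<in>UNIV. qform A (w k + c k *s s n)) =
        (\<Sum>k\<in>UNIV. qform A (v k)) + (\<Sum>n\<in>insert n N. qform A (s n))" if "A \<in> \<A>" for A
      using c(1)[OF that] w(1) that insert.hyps by simp
    show "(\<Sum>k\<in>UNIV. (norm (w k + c k *s s n))\<^sup>2) \<le>
        (\<Sum>k\<in>UNIV. (norm (v k))\<^sup>2) + (\<Sum>n\<in>insert n N. (norm (s n))\<^sup>2)"
      using c(2) w(2) insert.hyps by simp
    show "cdot (h j) (w k + c k *s s n) = cdot (h j) (v k)" for j k
      using w(3) by (simp add: cdot_add_right cdot_scale_right orth)
  qed
qed

section \<open>Rotating the sensing columns out of the users' sight\<close>

lemma norm_eq_tx_power: "(norm V)\<^sup>2 = tx_power (V :: complex^'c^'t)"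
proof -
  have "(norm V)\<^sup>2 = (\<Sum>i\<in>UNIV. \<Sum>n\<in>UNIV. (cmod (V $ i $ n))\<^sup>2)"
    by (simp add: norm_vec_def L2_set_def sum_nonneg)
  also have "\<dots> = tx_power V"
    by (simp add: tx_power_def trace_def matrix_matrix_mult_def flip: complex_norm_square)
  finally show ?thesis .
qed

lemma rotate_columns:
  fixes V :: "complex^'c^'t"
  assumes "p \<noteq> q" "cdot a (column q V) \<noteq> 0"
  obtains W :: "complex^'c^'t" where "W ** ctranspose W = V ** ctranspose V"
    "\<And>m. m \<noteq> p \<Longrightarrow> m \<noteq> q \<Longrightarrow> column m W = column m V"
    "cmod (cdot a (column p W)) > cmod (cdot a (column p V))"
proof -
  define x y where "x = cdot a (column p V)" and "y = cdot a (column q V)"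
  define r where "r = sqrt ((cmod x)\<^sup>2 + (cmod y)\<^sup>2)"
  have "cmod y > 0" using assms(2) by (simp add: y_def)
  then have r2: "r\<^sup>2 = (cmod x)\<^sup>2 + (cmod y)\<^sup>2" and "r > 0" and "r > cmod x"
    by (simp_all add: r_def add_nonneg_pos real_less_rsqrt)
  have r3: "of_real r * of_real r = x * cnj x + y * cnj y"
    using arg_cong[OF r2, of complex_of_real]
    by (simp only: of_real_add complex_norm_square) (simp add: power2_eq_square)
  \<comment> \<open>Columns \<open>p\<close> and \<open>q\<close> are mixed by a unitary matrix
    matched to their amplitudes \<open>x\<close> and \<open>y\<close>. Column \<open>p\<close>
    collects the full amplitude \<open>r\<close>, and column \<open>q\<close> becomes invisible to
    \<open>a\<close>.\<close>
  define W where "W = (\<chi> i m. if m = p then (cnj x * V $ i $ p + cnj y * V $ i $ q) / of_real r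
      else if m = q then (x * V $ i $ q - y * V $ i $ p) / of_real r else V $ i $ m)"
  have Wp: "W $ i $ p = (cnj x * V $ i $ p + cnj y * V $ i $ q) / of_real r"
    and Wq: "W $ i $ q = (x * V $ i $ q - y * V $ i $ p) / of_real r" for i
    using assms(1) by (simp_all add: W_def)
  have split: "(\<Sum>m\<in>UNIV. f m) = f p + f q + (\<Sum>m\<in>UNIV - {p} - {q}. f m)" for f :: "'c \<Rightarrow> complex"
    using assms(1) sum.remove[of UNIV p f] sum.remove[of "UNIV - {p}" q f] by (simp add: add.assoc)
  have pair: "W $ i $ p * cnj (W $ l $ p) + W $ i $ q * cnj (W $ l $ q) =
      V $ i $ p * cnj (V $ l $ p) + V $ i $ q * cnj (V $ l $ q)" for i l
  proof -
    have "W $ i $ p * cnj (W $ l $ p) + W $ i $ q * cnj (W $ l $ q) =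
       ((x * cnj x + y * cnj y) * (V $ i $ p * cnj (V $ l $ p) + V $ i $ q * cnj (V $ l $ q)))
        / (of_real r * of_real r)"
      unfolding Wp Wq complex_cnj_divide times_divide_times_eq complex_cnj_complex_of_real
        add_divide_distrib[symmetric] by (simp add: algebra_simps)
    then show ?thesis
      unfolding r3[symmetric] using \<open>r > 0\<close> by simp
  qed
  have "column p W = (cnj x / of_real r) *s column p V + (cnj y / of_real r) *s column q V"
    by (simp add: vec_eq_iff column_def Wp add_divide_distrib)
  then have "cdot a (column p W) = (cnj x * x + cnj y * y) / of_real r"
    by (simp add: cdot_add_right cdot_scale_right add_divide_distrib flip: x_def y_def)
  also have "\<dots> = of_real r"
    using r3 \<open>r > 0\<close> by (simp add: mult.commute field_simps)
  finally have "cmod (cdot a (column p W)) > cmod x"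
    using \<open>r > cmod x\<close> \<open>r > 0\<close> by simp
  moreover have "W ** ctranspose W = V ** ctranspose V"
    by (simp add: vec_eq_iff matrix_matrix_mult_def split pair) (simp add: W_def)
  moreover have "column m W = column m V" if "m \<noteq> p" "m \<noteq> q" for m
    using that by (simp add: column_def W_def)
  ultimately show thesis using that x_def by blast
qed

lemma hide_sensing_columns:
  fixes V :: "complex^('k::finite + 's::finite)^'t"
  obtains W :: "complex^('k + 's)^'t" where "W ** ctranspose W = V ** ctranspose V"
    "\<And>k. cmod (cdot (h k) (column (Inl k) W)) \<ge> cmod (cdot (h k) (column (Inl k) V))"
    "\<And>k n. cdot (h k) (column (Inr n) W) = 0"
proof -
  define sig where "sig W k = cmod (cdot (h k) (column (Inl k) W))" for k and W :: "complex^('k + 's)^'t"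
  \<comment> \<open>Fixing the Gram matrix fixes the norm, which makes \<open>S\<close> compact. The
    lower bounds are built in because maximizing the sum alone could weaken individual
    users.\<close>
  define S where "S = {W. W ** ctranspose W = V ** ctranspose V \<and> (\<forall>k. sig W k \<ge> sig V k)}"
  have cont_sig: "continuous_on UNIV (\<lambda>W. sig W k)" for k
    unfolding sig_def cdot_def column_def by (auto intro!: continuous_intros)
  have "closed S"
  proof -
    have "S = (\<Inter>i j. {W. (W ** ctranspose W) $ i $ j = (V ** ctranspose V) $ i $ j}) \<inter> (\<Inter>k. {W. sig V k \<le> sig W k})"
      by (auto simp: S_def vec_eq_iff)
    moreover have "closed {W. (W ** ctranspose W) $ i $ j = (V ** ctranspose V) $ i $ j}" for i j
      unfolding matrix_matrix_mult_def by (auto intro!: closed_Collect_eq continuous_intros)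
    moreover have "closed {W. sig V k \<le> sig W k}" for k
      by (intro closed_Collect_le continuous_intros cont_sig)
    ultimately show ?thesis by (auto intro!: closed_Int closed_INT)
  qed
  moreover have "bounded S"
  proof -
    have "norm W = norm V" if "W \<in> S" for W
    proof (rule power2_eq_imp_eq)
      show "(norm W)\<^sup>2 = (norm V)\<^sup>2"
        using that by (simp add: S_def norm_eq_tx_power tx_power_def)
    qed simp_all
    then show ?thesis by (metis boundedI order_refl)
  qed
  ultimately have "compact S" by (simp add: compact_eq_bounded_closed)
  moreover have "V \<in> S" by (simp add: S_def)
  moreover have "continuous_on S (\<lambda>W. \<Sum>k\<in>UNIV. sig W k)"
    using cont_sig by (intro continuous_on_sum) (auto intro: continuous_on_subset)
  ultimately obtain W where W: "W \<in> S" "\<And>X. X \<in> S \<Longrightarrow> (\<Sum>k\<in>UNIV. sig X k) \<le> (\<Sum>k\<in>UNIV. sig W k)"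
    using continuous_attains_sup[of S] by blast
  have "cdot (h k) (column (Inr n) W) = 0" for k n
  proof (rule ccontr)
    assume "cdot (h k) (column (Inr n) W) \<noteq> 0"
    then obtain X :: "complex^('k + 's)^'t" where X: "X ** ctranspose X = W ** ctranspose W"
      "\<And>m. m \<noteq> Inl k \<Longrightarrow> m \<noteq> Inr n \<Longrightarrow> column m X = column m W" "sig X k > sig W k"
      using rotate_columns[of "Inl k" "Inr n" "h k" W] unfolding sig_def by blast
    \<comment> \<open>The rotation touches only one communication column, that of user
      \<open>k\<close>; all other users keep their signal.\<close>
    then have ge: "sig X j \<ge> sig W j" for j
      by (cases "j = k") (auto simp: sig_def)
    with X W(1) have "X \<in> S"
      by (auto simp: S_def intro: order_trans)
    moreover have "(\<Sum>j\<in>UNIV. sig X j) > (\<Sum>j\<in>UNIV. sig W j)"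
      using X(3) ge by (intro sum_strict_mono_ex1) auto
    ultimately show False using W(2) by fastforce
  qed
  then show thesis
    using that W(1) by (auto simp: S_def sig_def)
qed

section \<open>SINR as a function of the signal power, and the number of constraints\<close>

text \<open>Interference is total received power minus signal power. The total depends only on the
  Gram matrix of \<open>V\<close>, so at a fixed Gram matrix only the signal term can vary.\<close>

lemma sinr_nic_eq:
  assumes "inj c"
  shows "sinr_nic c h \<sigma>2 V k = (cmod (cdot (h k) (column (c k) V)))\<^sup>2 /
    ((\<Sum>n\<in>UNIV. (cmod (cdot (h k) (column n V)))\<^sup>2) - (cmod (cdot (h k) (column (c k) V)))\<^sup>2 + \<sigma>2)"
proof -
  let ?p = "\<lambda>n. (cmod (cdot (h k) (column n V)))\<^sup>2"
  have "column n (sensing_part c V) = (if n \<in> range c then 0 else column n V)" for n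
    by (simp add: column_def sensing_part_def vec_eq_iff)
  then have "Re (cdot (h k) ((sensing_part c V ** ctranspose (sensing_part c V)) *v h k)) =
      (\<Sum>n\<in>UNIV. if n \<in> range c then 0 else ?p n)"
    unfolding cdot_gram Re_complex_of_real by (intro sum.cong) (auto simp: cdot_def)
  also have "\<dots> = (\<Sum>n\<in>- range c. ?p n)"
    by (simp add: sum.If_cases Compl_eq)
  also have "\<dots> = (\<Sum>n\<in>UNIV. ?p n) - (\<Sum>n\<in>range c. ?p n)"
    by (simp add: Compl_eq_Diff_UNIV sum_diff)
  also have "(\<Sum>n\<in>range c. ?p n) = ?p (c k) + (\<Sum>i\<in>UNIV - {k}. ?p (c i))"
    using assms by (simp add: sum.reindex sum.remove[of UNIV k])
  finally show ?thesis
    by (simp add: sinr_nic_def)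
qed

text \<open>A symmetric \<open>g\<close> factors through the unordered pair {i, j}, a set of one or
  two elements; such sets are counted.\<close>

lemma card_image_symmetric:
  fixes g :: "'l::finite \<Rightarrow> 'l \<Rightarrow> 'a"
  assumes "\<And>i j. g i j = g j i"
  shows "card (range (\<lambda>(i, j). g i j)) \<le> CARD('l) * (CARD('l) + 1) div 2"
proof -
  let ?m = "\<lambda>(i, j). {i, j} :: 'l set"
  let ?f = "\<lambda>(i, j). g i j"
  have "?f x = ?f (inv ?m (?m x))" for x
    using f_inv_into_f[of "?m x" ?m UNIV] assms by (auto simp: doubleton_eq_iff split: prod.splits)
  then have "range ?f \<subseteq> (?f \<circ> inv ?m) ` range ?m"
    by force
  then have "card (range ?f) \<le> card (range ?m)"
    by (rule surj_card_le[rotated]) simp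
  also have "\<dots> \<le> card ({A :: 'l set. card A = 1} \<union> {A. card A = 2})"
    by (intro card_mono) (auto simp: card_insert_if numeral_2_eq_2 split: if_splits)
  also have "\<dots> \<le> card {A :: 'l set. card A = 1} + card {A :: 'l set. card A = 2}"
    by (rule card_Un_le)
  also have "\<dots> = CARD('l) + (CARD('l) choose 2)"
    using n_subsets[of "UNIV :: 'l set" 1] n_subsets[of "UNIV :: 'l set" 2] by simp
  also have "\<dots> = CARD('l) * (CARD('l) + 1) div 2"
    by (cases "CARD('l)") (simp_all add: choose_two)
  finally show ?thesis .
qed

section \<open>Assembly of the result\<close>

theorem corollary1:
  fixes M :: "'w measure"
    and \<eta> :: "'w \<Rightarrow> real^'l"
    and f :: "real^'l \<Rightarrow> real"
    and G :: "real^'l \<Rightarrow> complex^'t^'r"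
    and \<Upsilon> :: nat
    and \<sigma>2 P :: real
    and h :: "'k::finite \<Rightarrow> complex^'t"
    and J :: "real^'l^'l"
    and \<gamma> :: "real^'k"
  assumes "prob_space M"
    and "\<And>x. f x \<ge> 0"
    and "distributed M lborel \<eta> (\<lambda>x. ennreal (f x))"
    and "\<And>i j. AE \<omega> in M. log_partial2_exists f i j (\<eta> \<omega>)"
    and "\<And>i j. integrable M (\<lambda>\<omega>. log_partial2 f i j (\<eta> \<omega>))"
    and "\<And>x. G differentiable (at x)"
    and "\<And>i j. integrable M (\<lambda>\<omega>. gram_deriv G i j (\<eta> \<omega>))"
    and "\<Upsilon> \<ge> 1" and "\<sigma>2 > 0" and "P > 0"
    and "real CARD('k) \<ge> real CARD('l) * (real CARD('l) + 1) / 4"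
    and "(J, \<gamma>) \<in> achievable_nic M \<eta> f G \<Upsilon> \<sigma>2 h P"
    and "\<And>k. \<gamma> $ k > 0"
  shows "\<exists>V' :: complex^'k^'t.
           bfim M \<eta> f G \<Upsilon> \<sigma>2 V' = J \<and>
           (\<forall>k. vsinr_nic id h \<sigma>2 V' $ k \<ge> \<gamma> $ k) \<and>
           tx_power V' \<le> P"
proof -
  obtain V :: "complex^('k + 't)^'t" where J: "J = bfim M \<eta> f G \<Upsilon> \<sigma>2 V"
    and \<gamma>: "\<gamma> = vsinr_nic Inl h \<sigma>2 V" and P: "tx_power V \<le> P"
    using assms(12) by (auto simp: achievable_nic_def)
  obtain W :: "complex^('k + 't)^'t" where W: "W ** ctranspose W = V ** ctranspose V"
    "\<And>k. cmod (cdot (h k) (column (Inl k) W)) \<ge> cmod (cdot (h k) (column (Inl k) V))"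
    "\<And>k n. cdot (h k) (column (Inr n) W) = 0"
    using hide_sensing_columns[where V = V and h = h] by metis
  let ?g = "gram_mean M \<eta> G"
  let ?A = "range (\<lambda>(i, j). ?g i j)"
  have "?g i j = ?g j i" for i j
    by (simp add: gram_mean_def gram_deriv_def add.commute)
  then have "card ?A \<le> CARD('l) * (CARD('l) + 1) div 2"
    by (rule card_image_symmetric)
  moreover have "real (CARD('l) * (CARD('l) + 1)) \<le> real (4 * CARD('k))"
    using assms(11) by (simp add: field_simps)
  ultimately have "card ?A \<le> 2 * CARD('k)"
    unfolding of_nat_le_iff by linarith
  from absorb_vectors[OF _ this, where v = "\<lambda>k. column (Inl k) W" and s = "\<lambda>n. column (Inr n) W"
      and N = UNIV and h = h] W(3)
  obtain w where w:
    "\<And>A. A \<in> ?A \<Longrightarrow> (\<Sum>k\<in>UNIV. qform A (w k)) =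
       (\<Sum>k\<in>UNIV. qform A (column (Inl k) W)) + (\<Sum>n\<in>UNIV. qform A (column (Inr n) W))"
    "(\<Sum>k\<in>UNIV. (norm (w k))\<^sup>2) \<le> (\<Sum>k\<in>UNIV. (norm (column (Inl k) W))\<^sup>2) + (\<Sum>n\<in>UNIV. (norm (column (Inr n) W))\<^sup>2)"
    "\<And>j k. cdot (h j) (w k) = cdot (h j) (column (Inl k) W)"
    by (auto simp del: split_paired_All)
  define V' where "V' = (\<chi> i k. w k $ i)"
  have col: "column k V' = w k" for k
    by (simp add: column_def V'_def vec_eq_iff)
  have sum_Plus: "(\<Sum>m\<in>UNIV. F m) = (\<Sum>k\<in>UNIV. F (Inl k)) + (\<Sum>n\<in>UNIV. F (Inr n))"
    for F :: "'k + 't \<Rightarrow> real"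
    using sum.Plus[of "UNIV :: 'k set" "UNIV :: 't set" F] by (simp add: o_def)
  have "Re (trace (?g i j ** V' ** ctranspose V')) = Re (trace (?g i j ** V ** ctranspose V))" for i j
  proof -
    have "Re (trace (?g i j ** V' ** ctranspose V')) = Re (trace (?g i j ** W ** ctranspose W))"
      using w(1)[OF rangeI[of _ "(i, j)"]] by (simp add: trace_mult_gram col qform_def sum_Plus)
    then show ?thesis
      by (metis W(1) matrix_mul_assoc)
  qed
  then have "bfim M \<eta> f G \<Upsilon> \<sigma>2 V' = J"
    by (simp add: J bfim_def data_info_def)
  moreover have "vsinr_nic id h \<sigma>2 V' $ k \<ge> \<gamma> $ k" for k
  proof -
    let ?T = "\<Sum>n\<in>UNIV. (cmod (cdot (h k) (column n V)))\<^sup>2"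
    let ?x = "(cmod (cdot (h k) (column (Inl k) V)))\<^sup>2"
    let ?y = "(cmod (cdot (h k) (column (Inl k) W)))\<^sup>2"
    \<comment> \<open>Total received power is a quadratic form of the Gram matrix, shared by
      \<open>V\<close> and \<open>W\<close>. It passes on to \<open>V'\<close> because the absorbed
      columns contribute nothing.\<close>
    have T: "?T = (\<Sum>n\<in>UNIV. (cmod (cdot (h k) (column n W)))\<^sup>2)"
      using cdot_gram[of "h k" V] cdot_gram[of "h k" W] W(1) by (metis of_real_eq_iff)
    then have T': "?T = (\<Sum>n\<in>UNIV. (cmod (cdot (h k) (column n V')))\<^sup>2)"
      by (simp add: sum_Plus W(3) col w(3))
    have "?x \<le> ?y" using W(2) by (simp add: power_mono)
    moreover have "?y \<le> ?T"
      unfolding T by (rule member_le_sum) auto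
    \<comment> \<open>More signal at the same total raises the numerator and lowers the denominator,
      which stays positive by \<open>?y \<le> ?T\<close> and the positive noise power.\<close>
    ultimately have "?x / (?T - ?x + \<sigma>2) \<le> ?y / (?T - ?y + \<sigma>2)"
      using assms(9) by (intro frac_le) auto
    then show ?thesis
      by (simp add: \<gamma> vsinr_nic_def sinr_nic_eq T' col w(3))
  qed
  moreover have "tx_power V' \<le> P"
  proof -
    have "tx_power V' \<le> tx_power W"
      using w(2) by (simp add: tx_power_eq col sum_Plus)
    also have "\<dots> = tx_power V" by (simp add: tx_power_def W(1))
    finally show ?thesis using P by simp
  qed
  ultimately show ?thesis by blast
qed

end
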